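(* Let $G$ be a connected graph on vertex set $[n]$ with Laplacian matrix $L$ and perturbation Laplacian matrix $\widehat{L}$, and let $L_{w}=L+\widehat{L}\varepsilon$ be the Laplacian matrix of the dual number weighted graph $G^{w}$. Then for all $i,j\in[n]$: (a) $R_{ij}(G^{w})=(L_{w}^{\dagger})_{ii}+(L_{w}^{\dagger})_{jj}-2(L_{w}^{\dagger})_{ij}=(L_{w}+\tfrac{1}{n}J)^{-1}_{ii}+(L_{w}+\tfrac{1}{n}J)^{-1}_{jj}-2(L_{w}+\tfrac{1}{n}J)^{-1}_{ij}$, and this equals $(L^{\dagger})_{ii}+(L^{\dagger})_{jj}-2(L^{\dagger})_{ij}-\big((L^{\dagger}\widehat{L}L^{\dagger})_{ii}+(L^{\dagger}\widehat{L}L^{\dagger})_{jj}-2(L^{\dagger}\widehat{L}L^{\dagger})_{ij}\big)\varepsilon = R_{ij}(G)-\big((L^{\dagger}\widehat{L}L^{\dagger})_{ii}+(L^{\dagger}\widehat{L}L^{\dagger})_{jj}-2(L^{\dagger}\widehat{L}L^{\dagger})_{ij}\big)\varepsilon$; (b) for any $\{1\}$-inverse $L_w^{\{1\}}$ of $L_w$ and any real $\{1\}$-inverse $L^{\{1\}}$ of $L$, $R_{ij}(G^{w})=(L_{w}^{\{1\}})_{ii}+(L_{w}^{\{1\}})_{jj}-(L_{w}^{\{1\}})_{ij}-(L_{w}^{\{1\}})_{ji}$, and $R_{ij}(G^{w})=(L^{\{1\}})_{ii}+(L^{\{1\}})_{jj}-(L^{\{1\}})_{ij}-(L^{\{1\}})_{ji}-\big((L^{\{1\}}\widehat{L}L^{\{1\}})_{ii}+(L^{\{1\}}\widehat{L}L^{\{1\}})_{jj}-(L^{\{1\}}\widehat{L}L^{\{1\}})_{ij}-(L^{\{1\}}\widehat{L}L^{\{1\}})_{ji}\big)\varepsilon$,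 where the real part $(L^{\{1\}})_{ii}+(L^{\{1\}})_{jj}-(L^{\{1\}})_{ij}-(L^{\{1\}})_{ji}$ equals $R_{ij}(G)$.
   Context: Dual numbers: $\mathbb{D}=\{a_s+a_d\varepsilon: a_s,a_d\in\mathbb{R}\}$ with $\varepsilon\neq 0$, $\varepsilon^2=0$. For a dual matrix $A$, a $\{1\}$-inverse is any $X$ with $AXA=A$; the Moore–Penrose inverse $A^{\dagger}$ is $X$ with $AXA=A$, $XAX=X$, $(AX)^T=AX$, $(XA)^T=XA$. $J$ is the $n\times n$ all-ones matrix. Dual number weighted graph: given $G=(V,E)$, $V=[n]$, and reals $\widehat{a}_e$ ($e\in E$), edge $e$ gets weight (conductance) $w(e)=1+\widehat{a}_e\varepsilon$, i.e. resistance $1-\widehat{a}_e\varepsilon$. $L=D-A$ is the Laplacian of $G$; the perturbation Laplacian is $\widehat{L}=\widehat{D}-\widehat{A}$ where $\widehat{A}_{ij}=\widehat{a}_e$ if $e=\{i,j\}\in E$ and $0$ otherwise, and $\widehat{D}$ is diagonal with $\widehat{D}_{ii}=\sum_j\widehat{A}_{ij}$; $L_w=L+\widehat{L}\varepsilon$. Resistance distance: $R_{ij}(G)$ is the effective resistance between $i$ and $j$ when a unit resistor is placed on every edge of $G$ (equivalently $(L^{\dagger})_{ii}+(L^{\dagger})_{jj}-2(L^{\dagger})_{ij}$). $R_{ij}(G^w)$ is the effective resistance in the network $G^w$: $R_{ii}(G^w)=0$, and for $i\neq j$, if a net current $Y>0$ enters at $i$ and leaves at $j$, Kirchhoff's and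 Ohm's laws give node potentials $v\in\mathbb{D}^n$ satisfying $L_wv=Y(\mathbf{1}_i-\mathbf{1}_j)$ (with $\mathbf{1}_k$ the $k$-th standard basis vector), and $R_{ij}(G^w)=(v_i-v_j)/Y$. *)

theory Defs
  imports "HOL-Analysis.Analysis"
begin

section \<open>Dual numbers\<close>

datatype dual_number = Dual (std_part: real) (dual_part: real)

lemma dual_number_eq_iff: "x = y \<longleftrightarrow> std_part x = std_part y \<and> dual_part x = dual_part y"
  by (cases x; cases y) simp

instantiation dual_number :: comm_ring_1
begin

definition "0 = Dual 0 0"
definition "1 = Dual 1 0"
definition "x + y = Dual (std_part x + std_part y) (dual_part x + dual_part y)"
definition "- x = Dual (- std_part x) (- dual_part x)"
definition "x - y = Dual (std_part x - std_part y) (dual_part x - dual_part y)"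
definition "x * y =
  Dual (std_part x * std_part y) (std_part x * dual_part y + dual_part x * std_part y)"

instance
  by standard
    (auto simp: zero_dual_number_def one_dual_number_def plus_dual_number_def
      uminus_dual_number_def minus_dual_number_def times_dual_number_def algebra_simps)

end

instantiation dual_number :: real_algebra_1
begin

definition "c *\<^sub>R x = Dual (c * std_part x) (c * dual_part x)"

instance
  by standard
    (auto simp: scaleR_dual_number_def plus_dual_number_def times_dual_number_def algebra_simps)

end

definition dual_eps :: dual_number  (\<open>\<epsilon>\<close>) where "\<epsilon> = Dual 0 1"

lemma dual_eps_neq_0: "\<epsilon> \<noteq> 0"
  by (simp add: dual_eps_def zero_dual_number_def)

lemma dual_eps_square: "\<epsilon>\<^sup>2 = 0"
  by (simp add: dual_eps_def zero_dual_number_def times_dual_number_def power2_eq_square)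

lemma of_real_dual: "of_real c = Dual c 0"
  by (simp add: of_real_def scaleR_dual_number_def one_dual_number_def)

lemma Dual_conv: "Dual s d = of_real s + of_real d * \<epsilon>"
  by (simp add: of_real_dual dual_eps_def plus_dual_number_def times_dual_number_def)

text \<open>The dual matrix with standard part \<open>A\<close> and dual part \<open>B\<close>, i.e. $A + B\varepsilon$.\<close>

definition dual_matrix :: "real^'n^'m \<Rightarrow> real^'n^'m \<Rightarrow> dual_number^'n^'m" where
  "dual_matrix A B = map_matrix of_real A + map_matrix (\<lambda>b. of_real b * \<epsilon>) B"


section \<open>Generalized inverses\<close>

definition is_one_inverse :: "'a::comm_ring_1^'n^'m \<Rightarrow> 'a^'m^'n \<Rightarrow> bool" where
  "is_one_inverse A X \<longleftrightarrow> A ** X ** A = A"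

definition is_mp_inverse :: "'a::comm_ring_1^'n^'m \<Rightarrow> 'a^'m^'n \<Rightarrow> bool" where
  "is_mp_inverse A X \<longleftrightarrow>
     A ** X ** A = A \<and> X ** A ** X = X \<and>
     transpose (A ** X) = A ** X \<and> transpose (X ** A) = X ** A"

text \<open>A dual matrix need not have a Moore--Penrose inverse, so \<open>mp_inverse A\<close> is meaningful
  only where existence is known; uniqueness always holds.\<close>

definition mp_inverse :: "'a::comm_ring_1^'n^'m \<Rightarrow> 'a^'m^'n" where
  "mp_inverse A = (THE X. is_mp_inverse A X)"

lemma is_mp_inverse_unique:
  fixes A :: "'a::comm_ring_1^'n^'m"
  assumes X: "is_mp_inverse A X" and Y: "is_mp_inverse A Y"
  shows "X = Y"
proof -
  have x: "A ** X ** A = A" "X ** A ** X = X"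
      "transpose (A ** X) = A ** X" "transpose (X ** A) = X ** A"
    and y: "A ** Y ** A = A" "Y ** A ** Y = Y"
      "transpose (A ** Y) = A ** Y" "transpose (Y ** A) = Y ** A"
    using X Y by (auto simp: is_mp_inverse_def)
  have "transpose ((A ** Y) ** (A ** X)) = (A ** X) ** (A ** Y)"
    by (simp only: matrix_transpose_mul[of "A ** Y" "A ** X"] x y)
  moreover have "(A ** Y) ** (A ** X) = A ** X" "(A ** X) ** (A ** Y) = A ** Y"
    using x(1) y(1) by (metis matrix_mul_assoc)+
  ultimately have AX: "A ** X = A ** Y"
    using x(3) by simp
  have "transpose ((X ** A) ** (Y ** A)) = (Y ** A) ** (X ** A)"
    by (simp only: matrix_transpose_mul[of "X ** A" "Y ** A"] x y)
  moreover have "(X ** A) ** (Y ** A) = X ** A" "(Y ** A) ** (X ** A) = Y ** A"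
    using x(1) y(1) by (simp_all flip: matrix_mul_assoc)
  ultimately have XA: "X ** A = Y ** A"
    using x(4) by simp
  have "X = Y ** (A ** X)"
    using x(2) XA by (simp add: matrix_mul_assoc)
  then show ?thesis
    using y(2) AX by (simp add: matrix_mul_assoc)
qed

lemma mp_inverse_eqI: "is_mp_inverse A X \<Longrightarrow> mp_inverse A = X"
  unfolding mp_inverse_def by (blast intro: the_equality is_mp_inverse_unique)

definition all_ones :: "'a::one^'n^'n" where
  "all_ones = (\<chi> i j. 1)"


section \<open>Graphs and their Laplacians\<close>

text \<open>A graph on the vertex set \<open>UNIV :: 'n set\<close>, with \<open>n = CARD('n)\<close>, is given by its set
  of edges, which are two-element sets of vertices.\<close>

definition simple_graph :: "'n set set \<Rightarrow> bool" where
  "simple_graph E \<longleftrightarrow> (\<forall>e\<in>E. card e = 2)"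

definition connected_graph :: "'n set set \<Rightarrow> bool" where
  "connected_graph E \<longleftrightarrow> (\<forall>u v. (u, v) \<in> {(x, y). {x, y} \<in> E}\<^sup>*)"

definition adjacency_matrix :: "'n set set \<Rightarrow> ('n set \<Rightarrow> 'a::comm_ring_1) \<Rightarrow> 'a^'n^'n" where
  "adjacency_matrix E w = (\<chi> i j. if {i, j} \<in> E then w {i, j} else 0)"

definition degree_matrix :: "'n::finite set set \<Rightarrow> ('n set \<Rightarrow> 'a::comm_ring_1) \<Rightarrow> 'a^'n^'n" where
  "degree_matrix E w = (\<chi> i j. if i = j then \<Sum>k\<in>UNIV. adjacency_matrix E w $ i $ k else 0)"

definition weighted_laplacian :: "'n::finite set set \<Rightarrow> ('n set \<Rightarrow> 'a::comm_ring_1) \<Rightarrow> 'a^'n^'n" where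
  "weighted_laplacian E w = degree_matrix E w - adjacency_matrix E w"

definition graph_laplacian :: "'n::finite set set \<Rightarrow> real^'n^'n" where
  "graph_laplacian E = weighted_laplacian E (\<lambda>_. 1)"

definition perturbation_laplacian :: "'n::finite set set \<Rightarrow> ('n set \<Rightarrow> real) \<Rightarrow> real^'n^'n" where
  "perturbation_laplacian E a = weighted_laplacian E a"

definition dual_weight :: "('n set \<Rightarrow> real) \<Rightarrow> 'n set \<Rightarrow> dual_number" where
  "dual_weight a e = 1 + of_real (a e) * \<epsilon>"

definition dual_laplacian :: "'n::finite set set \<Rightarrow> ('n set \<Rightarrow> real) \<Rightarrow> dual_number^'n^'n" where
  "dual_laplacian E a = dual_matrix (graph_laplacian E) (perturbation_laplacian E a)"

lemma dual_laplacian_conv_weighted_laplacian: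
  "dual_laplacian E a = weighted_laplacian E (dual_weight a)"
proof -
  have sum: "of_real (\<Sum>k\<in>UNIV. f k) + of_real (\<Sum>k\<in>UNIV. g k) * \<epsilon>
      = (\<Sum>k\<in>UNIV. of_real (f k) + of_real (g k) * \<epsilon>)" for f g :: "'a \<Rightarrow> real"
    by (simp add: sum.distrib sum_distrib_right)
  have adj: "of_real (adjacency_matrix E (\<lambda>_. 1) $ i $ j)
      + of_real (adjacency_matrix E a $ i $ j) * \<epsilon>
      = adjacency_matrix E (dual_weight a) $ i $ j" for i j
    by (simp add: adjacency_matrix_def dual_weight_def)
  have deg: "of_real (degree_matrix E (\<lambda>_. 1) $ i $ j)
      + of_real (degree_matrix E a $ i $ j) * \<epsilon>
      = degree_matrix E (dual_weight a) $ i $ j" for i j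
  proof (cases "i = j")
    case True
    then show ?thesis
      by (simp only: degree_matrix_def vec_lambda_beta if_True refl sum adj)
  qed (simp add: degree_matrix_def)
  have "dual_laplacian E a $ i $ j = weighted_laplacian E (dual_weight a) $ i $ j" for i j
  proof -
    have "dual_laplacian E a $ i $ j
        = (of_real (degree_matrix E (\<lambda>_. 1) $ i $ j) + of_real (degree_matrix E a $ i $ j) * \<epsilon>)
        - (of_real (adjacency_matrix E (\<lambda>_. 1) $ i $ j) + of_real (adjacency_matrix E a $ i $ j) * \<epsilon>)"
      by (simp add: dual_laplacian_def dual_matrix_def graph_laplacian_def
          perturbation_laplacian_def weighted_laplacian_def left_diff_distrib)
    also have "\<dots> = weighted_laplacian E (dual_weight a) $ i $ j"
      by (simp only: adj deg weighted_laplacian_def vector_minus_component)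
    finally show ?thesis .
  qed
  then show ?thesis
    by (simp add: vec_eq_iff)
qed


section \<open>Effective resistance\<close>

text \<open>The weights \<open>w\<close> are conductances. Kirchhoff's and Ohm's laws for a net current \<open>Y\<close> entering
  at \<open>i\<close> and leaving at \<open>j\<close> say that the node potentials \<open>v\<close> satisfy
  $L_w v = Y (\mathbf{1}_i - \mathbf{1}_j)$. The same definition serves real networks
  (\<open>'a = real\<close>) and dual number weighted networks (\<open>'a = dual_number\<close>).\<close>

definition is_potential ::
  "'n::finite set set \<Rightarrow> ('n set \<Rightarrow> 'a::{comm_ring_1,real_algebra_1}) \<Rightarrow> 'n \<Rightarrow> 'n \<Rightarrow> real \<Rightarrow> 'a^'n \<Rightarrow> bool"
  where
  "is_potential E w i j Y v \<longleftrightarrow>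
     weighted_laplacian E w *v v = Y *\<^sub>R (axis i 1 - axis j 1)"

text \<open>The value \<open>r\<close> must be obtained for every current and every choice of potentials.\<close>

definition is_effective_resistance ::
  "'n::finite set set \<Rightarrow> ('n set \<Rightarrow> 'a::{comm_ring_1,real_algebra_1}) \<Rightarrow> 'n \<Rightarrow> 'n \<Rightarrow> 'a \<Rightarrow> bool"
  where
  "is_effective_resistance E w i j r \<longleftrightarrow>
     (if i = j then r = 0
      else \<forall>Y>0. (\<exists>v. is_potential E w i j Y v) \<and>
                 (\<forall>v. is_potential E w i j Y v \<longrightarrow> r = (v $ i - v $ j) /\<^sub>R Y))"

definition effective_resistance ::
  "'n::finite set set \<Rightarrow> ('n set \<Rightarrow> 'a::{comm_ring_1,real_algebra_1}) \<Rightarrow> 'n \<Rightarrow> 'n \<Rightarrow> 'a"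
  where
  "effective_resistance E w i j = (THE r. is_effective_resistance E w i j r)"

lemma effective_resistance_eqI:
  assumes "is_effective_resistance E w i j r"
  shows "effective_resistance E w i j = r"
  unfolding effective_resistance_def
proof (rule the_equality)
  fix r' assume r': "is_effective_resistance E w i j r'"
  show "r' = r"
  proof (cases "i = j")
    case False
    then obtain v where "is_potential E w i j 1 v"
      using assms zero_less_one by (metis is_effective_resistance_def)
    then show ?thesis
      using False assms r' by (metis is_effective_resistance_def zero_less_one)
  qed (use assms r' in \<open>simp add: is_effective_resistance_def\<close>)
qed (fact assms)

text \<open>Resistance distance: a unit resistor on every edge.\<close>

definition resistance_distance :: "'n::finite set set \<Rightarrow> 'n \<Rightarrow> 'n \<Rightarrow> real" where
  "resistance_distance E i j = effective_resistance E (\<lambda>_. 1) i j"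

definition dual_resistance_distance ::
  "'n::finite set set \<Rightarrow> ('n set \<Rightarrow> real) \<Rightarrow> 'n \<Rightarrow> 'n \<Rightarrow> dual_number" where
  "dual_resistance_distance E a i j = effective_resistance E (dual_weight a) i j"

end

theory Submission
  imports Defs
begin

text \<open>
  Let \<open>Q\<close> be the averaging matrix $\frac1n J$. If \<open>L + Q\<close> has the inverse \<open>N\<close>, then \<open>Z = N - Q\<close>
  satisfies \<open>L Z = Z L = 1 - Q\<close>; so \<open>Z\<close> is the Moore--Penrose inverse of \<open>L\<close>, the current balance
  $\mathbf{1}_i - \mathbf{1}_j$ lies in the range of \<open>L\<close>, and potentials are unique up to
  constants. For a {1}-inverse \<open>X\<close> the vector $X(\mathbf{1}_i - \mathbf{1}_j)$ is therefore a
  potential, which gives the resistance. All of this is pure matrix algebra and works over the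
  reals and over the dual numbers alike. Over the reals \<open>L + Q\<close> is invertible by the maximum
  principle and connectedness; over the dual numbers invertibility is inherited from the standard
  part. Finally \<open>Lhat X L = Lhat\<close> for every real {1}-inverse \<open>X\<close> of \<open>L\<close>, since \<open>Lhat\<close> kills
  constants, and so $X - X \widehat{L} X \varepsilon$ is a {1}-inverse of $L_w$.
\<close>

section \<open>Matrix algebra\<close>

lemma matrix_add_rdistrib:
  fixes A B :: "'a::semiring_1^'n^'m"
  shows "(A + B) ** C = A ** C + B ** C"
  by (simp add: matrix_matrix_mult_def vec_eq_iff distrib_right sum.distrib)

lemma matrix_diff_ldistrib:
  fixes A :: "'a::ring_1^'n^'m"
  shows "A ** (B - C) = A ** B - A ** C"
  by (simp add: matrix_matrix_mult_def vec_eq_iff right_diff_distrib sum_subtractf)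

lemma matrix_diff_rdistrib:
  fixes A B :: "'a::ring_1^'n^'m"
  shows "(A - B) ** C = A ** C - B ** C"
  by (simp add: matrix_matrix_mult_def vec_eq_iff left_diff_distrib sum_subtractf)

lemma matrix_minus_left:
  fixes A :: "'a::ring_1^'n^'m"
  shows "(- A) ** B = - (A ** B)"
  by (simp add: matrix_matrix_mult_def vec_eq_iff sum_negf)

lemma matrix_minus_right:
  fixes A :: "'a::ring_1^'n^'m"
  shows "A ** (- B) = - (A ** B)"
  by (simp add: matrix_matrix_mult_def vec_eq_iff sum_negf)

lemma transpose_add: "transpose (A + B) = transpose A + transpose B"
  by (simp add: transpose_def vec_eq_iff)

lemma transpose_diff: "transpose (A - B) = transpose A - transpose B"
  by (simp add: transpose_def vec_eq_iff)

lemma transpose_eq_nth: "transpose A = A \<Longrightarrow> A $ i $ j = A $ j $ i"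
  by (metis transpose_def vec_lambda_beta)

lemma matrix_vector_mult_scaleR_algebra:
  fixes A :: "'a::real_algebra_1^'n^'m"
  shows "A *v (c *\<^sub>R x) = c *\<^sub>R (A *v x)"
  by (simp add: matrix_vector_mult_def vec_eq_iff scaleR_right.sum)

lemma matrix_inv_eqI:
  fixes A :: "'a::semiring_1^'n^'m"
  assumes "A ** B = mat 1" "B ** A = mat 1"
  shows "matrix_inv A = B"
  unfolding matrix_inv_def
proof (rule some_equality)
  fix C assume C: "A ** C = mat 1 \<and> C ** A = mat 1"
  have "C = C ** (A ** B)" using assms by simp
  also have "\<dots> = B" using C by (simp add: matrix_mul_assoc)
  finally show "C = B" .
qed (use assms in simp)

lemma is_mp_inverse_imp_is_one_inverse: "is_mp_inverse A X \<Longrightarrow> is_one_inverse A X"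
  by (simp add: is_mp_inverse_def is_one_inverse_def)

text \<open>This is the quadratic form of \<open>X\<close> at the vector
  \<open>axis i 1 - axis j 1\<close>. Both off-diagonal entries are kept because a {1}-inverse need
  not be symmetric.\<close>

definition resistance_form :: "'a::comm_ring_1^'n^'n \<Rightarrow> 'n \<Rightarrow> 'n \<Rightarrow> 'a" where
  "resistance_form X i j = X $ i $ i + X $ j $ j - X $ i $ j - X $ j $ i"

lemma resistance_form_symmetric:
  "transpose X = X \<Longrightarrow> resistance_form X i j = X $ i $ i + X $ j $ j - 2 * X $ i $ j"
  using transpose_eq_nth[of X i j] by (simp add: resistance_form_def)

lemma matrix_vector_mult_axis_diff:
  fixes X :: "'a::comm_ring_1^'n^'m"
  shows "(X *v (axis i 1 - axis j 1)) $ k = X $ k $ i - X $ k $ j"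
  by (simp add: matrix_vector_mult_diff_distrib)
    (simp add: matrix_vector_mult_def axis_def if_distrib cong: if_cong)

lemma resistance_form_eq_potential_difference:
  fixes X :: "'a::comm_ring_1^'n^'n"
  shows "resistance_form X i j
    = (X *v (axis i 1 - axis j 1)) $ i - (X *v (axis i 1 - axis j 1)) $ j"
  by (simp add: resistance_form_def matrix_vector_mult_axis_diff)


section \<open>Symmetric matrices with vanishing row sums\<close>

definition averaging :: "'a::real_algebra_1^'n^'n" where
  "averaging = (1 / real CARD('n)) *\<^sub>R all_ones"

lemma averaging_nth: "(averaging :: 'a::real_algebra_1^'n^'n) $ i $ j = of_real (1 / real CARD('n))"
  by (simp add: averaging_def all_ones_def of_real_def)

lemma transpose_averaging: "transpose averaging = averaging"
  by (simp add: transpose_def vec_eq_iff averaging_nth)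

lemma averaging_idem: "averaging ** averaging = (averaging :: 'a::real_algebra_1^'n^'n)"
proof -
  \<comment> \<open>The entry ring need not have division, so the cancellation of n against 1/n is
    done in the reals and transported by \<open>of_real\<close>.\<close>
  have "of_nat CARD('n) * (of_real (1 / real CARD('n)) * of_real (1 / real CARD('n)))
      = (of_real (real CARD('n) * (1 / real CARD('n) * (1 / real CARD('n)))) :: 'a)"
    by (simp only: of_real_mult of_real_of_nat_eq)
  also have "\<dots> = of_real (1 / real CARD('n))"
    by simp
  finally have "of_nat CARD('n) * (of_real (1 / real CARD('n)) * of_real (1 / real CARD('n)))
      = (of_real (1 / real CARD('n)) :: 'a)" .
  then show ?thesis
    by (simp add: vec_eq_iff matrix_matrix_mult_def averaging_nth)
qed

lemma averaging_mult_constant: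
  fixes x :: "'a::real_algebra_1^'n"
  assumes "\<And>i j. x $ i = x $ j"
  shows "averaging *v x = x"
proof -
  have "(averaging *v x) $ i = x $ i" for i
  proof -
    have "(averaging *v x) $ i = (\<Sum>k\<in>(UNIV::'n set). (1 / real CARD('n)) *\<^sub>R x $ k)"
      unfolding matrix_vector_mult_def vec_lambda_beta averaging_nth scaleR_conv_of_real ..
    also have "\<dots> = (\<Sum>k\<in>(UNIV::'n set). (1 / real CARD('n)) *\<^sub>R x $ i)"
      by (intro sum.cong refl arg_cong[where f = "scaleR _"] assms)
    also have "\<dots> = x $ i"
      by (simp add: sum_constant_scaleR del: sum_constant)
    finally show ?thesis .
  qed
  then show ?thesis by (simp add: vec_eq_iff)
qed

lemma matrix_mult_averaging:
  fixes A :: "'a::real_algebra_1^'n^'m"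
  assumes "\<And>i. (\<Sum>k\<in>UNIV. A $ i $ k) = 0"
  shows "A ** averaging = 0"
  by (simp add: vec_eq_iff matrix_matrix_mult_def averaging_nth assms flip: sum_distrib_right)

lemma averaging_mult_symmetric:
  fixes A :: "'a::{comm_ring_1,real_algebra_1}^'n^'n"
  assumes "transpose A = A" "A ** averaging = 0"
  shows "averaging ** A = 0"
proof -
  have "transpose (averaging ** A) = 0"
    by (simp only: matrix_transpose_mul assms transpose_averaging)
  then show ?thesis by (metis transpose_transpose transpose_mat mat_0)
qed

lemma averaging_axis_diff:
  "averaging *v (axis i 1 - axis j 1) = (0 :: 'a::{comm_ring_1,real_algebra_1}^'n)"
  by (simp add: vec_eq_iff matrix_vector_mult_axis_diff averaging_nth)

text \<open>Invertibility is assumed here because it is obtained differently over the reals and over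
  the dual numbers; what follows from it is shared.\<close>

locale averaged_inverse =
  fixes A N :: "'a::{comm_ring_1,real_algebra_1}^'n^'n"
  assumes sym: "transpose A = A"
    and A_averaging: "A ** averaging = 0"
    and right_inv: "(A + averaging) ** N = mat 1"
    and left_inv: "N ** (A + averaging) = mat 1"
begin

definition Z :: "'a^'n^'n" where "Z = N - averaging"

lemma averaging_A: "averaging ** A = 0"
  by (rule averaging_mult_symmetric) (rule sym A_averaging)+

text \<open>\<open>A + averaging\<close> fixes \<open>averaging\<close> under multiplication, hence
  so does its inverse.\<close>

lemma N_averaging: "N ** averaging = averaging"
proof -
  have "N ** averaging = N ** ((A + averaging) ** averaging)"
    by (simp add: matrix_add_rdistrib A_averaging averaging_idem)
  also have "\<dots> = averaging" by (simp add: matrix_mul_assoc left_inv)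
  finally show ?thesis .
qed

lemma averaging_N: "averaging ** N = averaging"
proof -
  have "averaging ** N = (averaging ** (A + averaging)) ** N"
    by (simp add: matrix_add_ldistrib averaging_A averaging_idem)
  also have "\<dots> = averaging" by (simp add: right_inv flip: matrix_mul_assoc)
  finally show ?thesis .
qed

lemma A_Z: "A ** Z = mat 1 - averaging"
proof -
  have "A ** N + averaging = mat 1"
    using right_inv by (simp add: matrix_add_rdistrib averaging_N)
  then show ?thesis
    by (simp add: Z_def matrix_diff_ldistrib A_averaging eq_diff_eq)
qed

lemma Z_A: "Z ** A = mat 1 - averaging"
proof -
  have "N ** A + averaging = mat 1"
    using left_inv by (simp add: matrix_add_ldistrib N_averaging)
  then show ?thesis
    by (simp add: Z_def matrix_diff_rdistrib averaging_A eq_diff_eq)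
qed

text \<open>Both products of \<open>A\<close> and \<open>Z\<close> are the symmetric projection
  \<open>mat 1 - averaging\<close>, which acts as the identity on \<open>A\<close> and on
  \<open>Z\<close>.\<close>

lemma is_mp_inverse_Z: "is_mp_inverse A Z"
proof -
  have "averaging ** Z = 0"
    by (simp add: Z_def matrix_diff_ldistrib averaging_N averaging_idem)
  then have "(mat 1 - averaging) ** A = A" "(mat 1 - averaging) ** Z = Z"
    by (simp_all add: matrix_diff_rdistrib averaging_A)
  moreover have "transpose (mat 1 - averaging) = (mat 1 - averaging :: 'a^'n^'n)"
    by (simp add: transpose_diff transpose_averaging)
  ultimately show ?thesis
    unfolding is_mp_inverse_def A_Z Z_A by blast
qed

lemma mp_inverse_eq: "mp_inverse A = Z"
  by (rule mp_inverse_eqI) (rule is_mp_inverse_Z)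

lemma transpose_N: "transpose N = N"
proof -
  have "transpose (N ** (A + averaging)) = mat 1"
    by (simp only: left_inv transpose_mat)
  then have "(A + averaging) ** transpose N = mat 1"
    by (simp only: matrix_transpose_mul transpose_add sym transpose_averaging)
  then have "N ** ((A + averaging) ** transpose N) = N" by simp
  then show ?thesis by (simp add: matrix_mul_assoc left_inv)
qed

lemma transpose_Z: "transpose Z = Z"
  by (simp add: Z_def transpose_diff transpose_N transpose_averaging)

lemma invertible: "invertible (A + averaging)"
  using right_inv left_inv by (auto simp: invertible_def)

lemma matrix_inv_eq: "matrix_inv (A + averaging) = N"
  by (rule matrix_inv_eqI) (rule right_inv left_inv)+

text \<open>\<open>N\<close> and \<open>Z\<close> differ by a matrix with equal entries, and the
  signs of the four terms of the form cancel it.\<close>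

lemma resistance_form_N: "resistance_form N i j = resistance_form Z i j"
  by (simp add: resistance_form_def Z_def averaging_nth)

lemma kernel_constant:
  assumes "A *v x = 0"
  shows "x $ i = x $ j"
proof -
  have "(Z ** A) *v x = 0"
    using assms by (simp flip: matrix_vector_mul_assoc)
  then have "x = averaging *v x"
    by (simp add: Z_A matrix_vector_mult_diff_rdistrib)
  moreover have "(averaging *v x) $ i = (averaging *v x) $ j"
    by (simp add: matrix_vector_mult_def averaging_nth)
  ultimately show ?thesis by metis
qed

text \<open>For any {1}-inverse, \<open>A ** X\<close> fixes the range of \<open>A\<close>. The
  injected current has zero total, so \<open>averaging\<close> kills it and \<open>A ** Z\<close>
  shows it to lie in that range.\<close>

lemma one_inverse_potential:
  assumes "is_one_inverse A X"
  shows "A *v (X *v (axis i 1 - axis j 1)) = axis i 1 - axis j 1"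
proof -
  let ?b = "axis i 1 - axis j 1 :: 'a^'n"
  have b: "?b = A *v (Z *v ?b)"
    by (simp add: matrix_vector_mul_assoc A_Z matrix_vector_mult_diff_rdistrib averaging_axis_diff)
  have "A *v (X *v (A *v (Z *v ?b))) = (A ** X ** A) *v (Z *v ?b)"
    by (simp only: matrix_vector_mul_assoc matrix_mul_assoc)
  also have "\<dots> = A *v (Z *v ?b)"
    using assms by (simp add: is_one_inverse_def)
  finally have "A *v (X *v (A *v (Z *v ?b))) = A *v (Z *v ?b)" .
  then show ?thesis by (simp flip: b)
qed

lemma is_effective_resistance_one_inverse:
  assumes A: "A = weighted_laplacian E w" and X: "is_one_inverse A X"
  shows "is_effective_resistance E w i j (resistance_form X i j)"
proof (cases "i = j")
  case True
  then show ?thesis by (simp add: is_effective_resistance_def resistance_form_def)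
next
  case False
  let ?b = "axis i 1 - axis j 1 :: 'a^'n"
  have pot: "is_potential E w i j Y (Y *\<^sub>R (X *v ?b))" for Y
    by (simp add: is_potential_def matrix_vector_mult_scaleR_algebra
        one_inverse_potential[OF X] flip: A)
  have "resistance_form X i j = (v $ i - v $ j) /\<^sub>R Y"
    if Y: "Y > 0" and v: "is_potential E w i j Y v" for Y v
  proof -
    \<comment> \<open>Two potentials for the same current differ by a kernel vector, which is
      constant and so drops out of the difference between \<open>i\<close> and
      \<open>j\<close>.\<close>
    have "A *v (v - Y *\<^sub>R (X *v ?b)) = 0"
      using pot[of Y] v by (simp add: is_potential_def matrix_vector_mult_diff_distrib flip: A)
    from kernel_constant[OF this, of i j]
    have "v $ i - v $ j = Y *\<^sub>R resistance_form X i j"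
      by (simp add: resistance_form_eq_potential_difference scaleR_diff_right algebra_simps)
    then show ?thesis using Y by simp
  qed
  with False pot show ?thesis
    by (auto simp: is_effective_resistance_def)
qed

end


section \<open>Laplacians\<close>

lemma adjacency_matrix_commute: "adjacency_matrix E w $ i $ j = adjacency_matrix E w $ j $ i"
  by (simp add: adjacency_matrix_def insert_commute)

lemma transpose_weighted_laplacian: "transpose (weighted_laplacian E w) = weighted_laplacian E w"
  by (auto simp: transpose_def vec_eq_iff weighted_laplacian_def degree_matrix_def
      adjacency_matrix_commute)

text \<open>The net current out of vertex \<open>i\<close>, as conductance times potential drop.
  This form yields both the zero row sums and the maximum principle.\<close>

lemma weighted_laplacian_mult_nth:
  "(weighted_laplacian E w *v x) $ i
    = (\<Sum>k\<in>UNIV. adjacency_matrix E w $ i $ k * (x $ i - x $ k))"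
proof -
  have "(degree_matrix E w *v x) $ i = (\<Sum>k\<in>UNIV. adjacency_matrix E w $ i $ k) * x $ i"
    by (simp add: matrix_vector_mult_def degree_matrix_def if_distrib[of "\<lambda>c. c * _"] cong: if_cong)
  then show ?thesis
    by (simp add: weighted_laplacian_def matrix_vector_mult_diff_rdistrib right_diff_distrib
        sum_subtractf sum_distrib_right) (simp add: matrix_vector_mult_def)
qed

lemma weighted_laplacian_averaging:
  fixes w :: "'n::finite set \<Rightarrow> 'a::{comm_ring_1,real_algebra_1}"
  shows "weighted_laplacian E w ** averaging = 0"
proof (rule matrix_mult_averaging)
  show "(\<Sum>k\<in>UNIV. weighted_laplacian E w $ i $ k) = 0" for i
    using weighted_laplacian_mult_nth[of E w "1" i]
    by (simp add: matrix_vector_mult_def)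
qed

lemma graph_laplacian_kernel:
  fixes x :: "real^'n"
  assumes conn: "connected_graph E" and x: "graph_laplacian E *v x = 0"
  shows "x $ i = x $ j"
proof -
  \<comment> \<open>Maximum principle: at a vertex of maximal value all summands are nonnegative and
    add up to zero, so each neighbour attains the maximum too; connectedness spreads it to every
    vertex.\<close>
  obtain u where u: "\<And>k. x $ k \<le> x $ u"
    using Max_in[of "range (($) x)"] Max_ge[of "range (($) x)"] that by fastforce
  have step: "x $ q = x $ u" if p: "x $ p = x $ u" and e: "{p, q} \<in> E" for p q
  proof -
    have "(\<Sum>k\<in>UNIV. adjacency_matrix E (\<lambda>_. 1) $ p $ k * (x $ p - x $ k)) = 0"
      using x by (simp add: graph_laplacian_def flip: weighted_laplacian_mult_nth)
    moreover have "adjacency_matrix E (\<lambda>_. 1) $ p $ k * (x $ p - x $ k) \<ge> 0" for k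
      using p u by (simp add: adjacency_matrix_def)
    ultimately have "adjacency_matrix E (\<lambda>_. 1) $ p $ q * (x $ p - x $ q) = 0"
      by (simp add: sum_nonneg_eq_0_iff)
    then show ?thesis using p e by (simp add: adjacency_matrix_def)
  qed
  have "x $ k = x $ u" for k
  proof -
    have "(u, k) \<in> {(x, y). {x, y} \<in> E}\<^sup>*"
      using conn by (simp add: connected_graph_def)
    then show ?thesis by induction (auto intro: step)
  qed
  then show ?thesis by metis
qed

lemma graph_laplacian_averaged_inverse:
  fixes E :: "'n::finite set set"
  assumes "connected_graph E"
  obtains N where "averaged_inverse (graph_laplacian E) N"
proof -
  let ?L = "graph_laplacian E"
  have sym: "transpose ?L = ?L" and LQ: "?L ** averaging = 0"
    by (simp_all add: graph_laplacian_def transpose_weighted_laplacian weighted_laplacian_averaging)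
  have QL: "averaging ** ?L = 0"
    by (rule averaging_mult_symmetric) (rule sym LQ)+
  \<comment> \<open>Multiplying by \<open>averaging\<close> splits the equation: x has mean zero and
    lies in the kernel of the Laplacian. The latter makes x constant, so it vanishes.\<close>
  have "x = 0" if x: "(?L + averaging) *v x = 0" for x
  proof -
    have "(averaging ** (?L + averaging)) *v x = 0"
      using x by (simp flip: matrix_vector_mul_assoc)
    then have Qx: "averaging *v x = 0"
      by (simp add: matrix_add_ldistrib QL averaging_idem)
    then have "?L *v x = 0"
      using x by (simp add: matrix_vector_mult_add_rdistrib)
    then have "averaging *v x = x"
      by (intro averaging_mult_constant graph_laplacian_kernel[OF assms])
    with Qx show ?thesis by simp
  qed
  then obtain N where N: "N ** (?L + averaging) = mat 1"
    using matrix_left_invertible_ker by blast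
  then have "(?L + averaging) ** N = mat 1"
    by (simp add: matrix_left_right_inverse)
  then show ?thesis
    using that N sym LQ by (simp add: averaged_inverse_def)
qed


section \<open>Dual matrices\<close>

lemma dual_matrix_nth: "dual_matrix A B $ i $ j = Dual (A $ i $ j) (B $ i $ j)"
  by (simp add: dual_matrix_def Dual_conv)

lemma sum_Dual: "(\<Sum>k\<in>S. Dual (f k) (g k)) = Dual (sum f S) (sum g S)"
  by (induction S rule: infinite_finite_induct)
    (simp_all add: zero_dual_number_def plus_dual_number_def)

lemma dual_matrix_mult:
  "dual_matrix A B ** dual_matrix C D = dual_matrix (A ** C) (A ** D + B ** C)"
  by (simp add: vec_eq_iff matrix_matrix_mult_def dual_matrix_nth times_dual_number_def
      sum_Dual sum.distrib)

lemma dual_matrix_mat_1: "dual_matrix (mat 1) 0 = mat 1"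
  by (simp add: vec_eq_iff dual_matrix_nth mat_def zero_dual_number_def one_dual_number_def)

lemma dual_matrix_averaging: "dual_matrix averaging 0 = averaging"
  by (simp add: vec_eq_iff dual_matrix_nth averaging_nth of_real_dual)

lemma dual_matrix_add: "dual_matrix A B + dual_matrix C D = dual_matrix (A + C) (B + D)"
  by (simp add: vec_eq_iff dual_matrix_nth plus_dual_number_def)

lemma resistance_form_dual_matrix:
  "resistance_form (dual_matrix A B) i j
    = of_real (resistance_form A i j) + of_real (resistance_form B i j) * \<epsilon>"
  unfolding Dual_conv[symmetric]
  by (simp add: resistance_form_def dual_matrix_nth plus_dual_number_def minus_dual_number_def)

lemma resistance_form_minus: "resistance_form (- A) i j = - resistance_form A i j"
  by (simp add: resistance_form_def)

text \<open>The candidate is the first-order Neumann expansion of the inverse around the real part,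
  exact because the square of \<open>dual_eps\<close> is zero.\<close>

lemma dual_laplacian_averaged_inverse:
  fixes E :: "'n::finite set set"
  assumes "averaged_inverse (graph_laplacian E) N"
  shows "averaged_inverse (dual_laplacian E a)
    (dual_matrix N (- (N ** perturbation_laplacian E a ** N)))"
proof -
  interpret averaged_inverse "graph_laplacian E" N by fact
  let ?B = "perturbation_laplacian E a"
  have sum: "dual_laplacian E a + averaging = dual_matrix (graph_laplacian E + averaging) ?B"
    by (simp add: dual_laplacian_def dual_matrix_add flip: dual_matrix_averaging)
  have "(graph_laplacian E + averaging) ** (N ** ?B ** N) = ?B ** N"
    by (simp add: matrix_mul_assoc right_inv)
  moreover have "(N ** ?B ** N) ** (graph_laplacian E + averaging) = N ** ?B"
    by (simp add: left_inv flip: matrix_mul_assoc)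
  ultimately show ?thesis
    by unfold_locales
      (simp_all add: sum dual_matrix_mult matrix_minus_left matrix_minus_right right_inv left_inv
        dual_matrix_mat_1,
       simp_all add: dual_laplacian_conv_weighted_laplacian transpose_weighted_laplacian
        weighted_laplacian_averaging)
qed

lemma dual_laplacian_one_inverse:
  fixes E :: "'n::finite set set"
  assumes "averaged_inverse (graph_laplacian E) N" and X: "is_one_inverse (graph_laplacian E) X"
  shows "is_one_inverse (dual_laplacian E a)
    (dual_matrix X (- (X ** perturbation_laplacian E a ** X)))"
proof -
  interpret averaged_inverse "graph_laplacian E" N by fact
  let ?L = "graph_laplacian E" and ?B = "perturbation_laplacian E a"
  have LXL: "?L ** X ** ?L = ?L" using X by (simp add: is_one_inverse_def)
  have "?B ** averaging = 0"
    by (simp add: perturbation_laplacian_def weighted_laplacian_averaging)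
  \<comment> \<open>Killing constants lets \<open>?B\<close> factor through \<open>?L\<close> on the
    right, after which the {1}-inverse property of \<open>X\<close> can be used.\<close>
  then have BZL: "?B ** (Z ** ?L) = ?B"
    by (simp add: Z_A matrix_diff_ldistrib)
  have "?B ** X ** ?L = ?B ** (Z ** ?L) ** X ** ?L" by (simp only: BZL)
  also have "\<dots> = ?B ** (Z ** (?L ** X ** ?L))" by (simp only: matrix_mul_assoc)
  also have "\<dots> = ?B" by (simp only: LXL BZL)
  finally have BXL: "?B ** X ** ?L = ?B" .
  have "?L ** (X ** ?B ** X) ** ?L = ?L ** X ** (?B ** X ** ?L)"
    by (simp only: matrix_mul_assoc)
  then have LXBXL: "?L ** (X ** ?B ** X) ** ?L = ?L ** X ** ?B" by (simp only: BXL)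
  \<comment> \<open>The dual part of the triple product is LXB - LXBXL + BXL, with L, B standing for
    \<open>?L\<close>, \<open>?B\<close>. The first two terms cancel and the third is B.\<close>
  show ?thesis
    by (simp add: is_one_inverse_def dual_laplacian_def dual_matrix_mult LXL BXL LXBXL
        matrix_diff_rdistrib matrix_minus_right)
qed

text \<open>Resistances, Moore-Penrose inverses and \<open>matrix_inv\<close> are defined by
  description operators, so the first group of conjuncts certifies that the objects described
  exist.\<close>

theorem theorem3p3:
  fixes E :: "'n::finite set set"
    and a :: "'n set \<Rightarrow> real"
    and L Lhat :: "real^'n^'n"
    and Lw M :: "dual_number^'n^'n"
    and i j :: 'n
  assumes "simple_graph E" and "connected_graph E"
    and L: "L = graph_laplacian E"
    and Lhat: "Lhat = perturbation_laplacian E a"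
    and Lw: "Lw = dual_laplacian E a"
    and M: "M = Lw + (1 / real CARD('n)) *\<^sub>R all_ones"
  shows
    "(is_effective_resistance E (\<lambda>_. 1) i j (resistance_distance E i j)
      \<and> is_effective_resistance E (dual_weight a) i j (dual_resistance_distance E a i j)
      \<and> is_mp_inverse L (mp_inverse L)
      \<and> is_mp_inverse Lw (mp_inverse Lw)
      \<and> invertible M)
     \<and>
     (dual_resistance_distance E a i j
        = mp_inverse Lw $ i $ i + mp_inverse Lw $ j $ j - 2 * mp_inverse Lw $ i $ j
      \<and> dual_resistance_distance E a i j
        = matrix_inv M $ i $ i + matrix_inv M $ j $ j - 2 * matrix_inv M $ i $ j
      \<and> dual_resistance_distance E a i j
        = of_real (mp_inverse L $ i $ i + mp_inverse L $ j $ j - 2 * mp_inverse L $ i $ j)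
          - of_real ((mp_inverse L ** Lhat ** mp_inverse L) $ i $ i
                     + (mp_inverse L ** Lhat ** mp_inverse L) $ j $ j
                     - 2 * (mp_inverse L ** Lhat ** mp_inverse L) $ i $ j) * \<epsilon>
      \<and> dual_resistance_distance E a i j
        = of_real (resistance_distance E i j)
          - of_real ((mp_inverse L ** Lhat ** mp_inverse L) $ i $ i
                     + (mp_inverse L ** Lhat ** mp_inverse L) $ j $ j
                     - 2 * (mp_inverse L ** Lhat ** mp_inverse L) $ i $ j) * \<epsilon>)
     \<and>
     (\<forall>X. is_one_inverse Lw X \<longrightarrow>
        dual_resistance_distance E a i j = X $ i $ i + X $ j $ j - X $ i $ j - X $ j $ i)
     \<and>
     (\<forall>X. is_one_inverse L X \<longrightarrow>
        dual_resistance_distance E a i j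
          = of_real (X $ i $ i + X $ j $ j - X $ i $ j - X $ j $ i)
            - of_real ((X ** Lhat ** X) $ i $ i + (X ** Lhat ** X) $ j $ j
                       - (X ** Lhat ** X) $ i $ j - (X ** Lhat ** X) $ j $ i) * \<epsilon>
        \<and> X $ i $ i + X $ j $ j - X $ i $ j - X $ j $ i = resistance_distance E i j)"
proof -
  obtain N where N: "averaged_inverse (graph_laplacian E) N"
    using graph_laplacian_averaged_inverse[OF \<open>connected_graph E\<close>] .
  interpret R: averaged_inverse L N using N by (simp add: L)
  define N' where "N' = dual_matrix N (- (N ** Lhat ** N))"
  interpret D: averaged_inverse Lw N'
    using dual_laplacian_averaged_inverse[OF N] by (simp add: Lw N'_def Lhat)
  have M': "M = Lw + averaging" by (simp add: M averaging_def)
  have real_res: "is_effective_resistance E (\<lambda>_. 1) i j (resistance_form X i j)"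
    if "is_one_inverse L X" for X
    using R.is_effective_resistance_one_inverse[OF _ that] by (simp add: L graph_laplacian_def)
  have dual_res: "is_effective_resistance E (dual_weight a) i j (resistance_form X i j)"
    if "is_one_inverse Lw X" for X
    using D.is_effective_resistance_one_inverse[OF _ that]
    by (simp add: Lw dual_laplacian_conv_weighted_laplacian)
  have real_eq: "resistance_distance E i j = resistance_form X i j" if "is_one_inverse L X" for X
    unfolding resistance_distance_def by (rule effective_resistance_eqI) (rule real_res[OF that])
  have dual_eq: "dual_resistance_distance E a i j = resistance_form X i j"
    if "is_one_inverse Lw X" for X
    unfolding dual_resistance_distance_def
    by (rule effective_resistance_eqI) (rule dual_res[OF that])
  have expand: "dual_resistance_distance E a i j
      = of_real (resistance_form X i j) - of_real (resistance_form (X ** Lhat ** X) i j) * \<epsilon>"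
    if X: "is_one_inverse L X" for X
    using dual_laplacian_one_inverse[OF N, of X a] X
    by (simp add: dual_eq Lw Lhat L resistance_form_dual_matrix resistance_form_minus)
  have Z: "is_one_inverse L R.Z" and Z': "is_one_inverse Lw D.Z"
    by (simp_all add: is_mp_inverse_imp_is_one_inverse R.is_mp_inverse_Z D.is_mp_inverse_Z)
  have "transpose Lhat = Lhat"
    by (simp add: Lhat perturbation_laplacian_def transpose_weighted_laplacian)
  then have "transpose (R.Z ** Lhat ** R.Z) = R.Z ** Lhat ** R.Z"
    by (simp only: matrix_transpose_mul R.transpose_Z matrix_mul_assoc)
  \<comment> \<open>For symmetric matrices the expressions with the factor 2 fold into
    \<open>resistance_form\<close>, so that parts (a) and (b) become instances of the same
    equations.\<close>
  note form = resistance_form_symmetric[OF this, symmetric]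
    resistance_form_symmetric[OF R.transpose_Z, symmetric]
    resistance_form_symmetric[OF D.transpose_Z, symmetric]
    resistance_form_symmetric[OF D.transpose_N, symmetric]
  have "is_effective_resistance E (\<lambda>_. 1) i j (resistance_distance E i j)"
    "is_effective_resistance E (dual_weight a) i j (dual_resistance_distance E a i j)"
    using real_res[OF Z] dual_res[OF Z'] by (simp_all only: real_eq[OF Z] dual_eq[OF Z'])
  moreover have "dual_resistance_distance E a i j = resistance_form N' i j"
    by (simp only: dual_eq[OF Z'] D.resistance_form_N)
  ultimately show ?thesis
    unfolding R.mp_inverse_eq D.mp_inverse_eq M' D.matrix_inv_eq form
      resistance_form_def[symmetric]
    using R.is_mp_inverse_Z D.is_mp_inverse_Z D.invertible dual_eq[OF Z'] expand[OF Z] real_eq[OF Z]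
      dual_eq expand real_eq
    by metis
qed

end
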